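(* If $G$ is a finite $5$-centralizer group, then the non-commuting graph $\mathcal{A}_G$ is L-integral.
   Context: A finite group $G$ is an $n$-centralizer group if the set $\{C_G(x) : x \in G\}$ of element centralizers has exactly $n$ distinct members (including $G = C_G(1)$). For a finite non-abelian group $G$ with centre $Z(G)$, the non-commuting graph $\mathcal{A}_G$ is the simple undirected graph with vertex set $G \setminus Z(G)$ in which two vertices $x,y$ are adjacent if and only if $xy \neq yx$. A finite graph is L-integral if all eigenvalues of its Laplacian matrix $D - A$ ($D$ the degree matrix, $A$ the adjacency matrix) are integers. *)

theory Defs
  imports
    "HOL-Algebra.Group"
    "Graph_Theory.Pair_Digraph"
    "Jordan_Normal_Form.Char_Poly"
begin

definition elem_centralizer :: "('a, 'b) monoid_scheme \<Rightarrow> 'a \<Rightarrow> 'a set" where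
  "elem_centralizer G x = {y \<in> carrier G. x \<otimes>\<^bsub>G\<^esub> y = y \<otimes>\<^bsub>G\<^esub> x}"

definition group_center :: "('a, 'b) monoid_scheme \<Rightarrow> 'a set" where
  "group_center G = {z \<in> carrier G. \<forall>y \<in> carrier G. z \<otimes>\<^bsub>G\<^esub> y = y \<otimes>\<^bsub>G\<^esub> z}"

definition n_centralizer_group :: "nat \<Rightarrow> ('a, 'b) monoid_scheme \<Rightarrow> bool" where
  "n_centralizer_group n G \<longleftrightarrow>
     group G \<and> finite (carrier G) \<and> card (elem_centralizer G ` carrier G) = n"

text \<open>
  Undirected graphs are represented, as usual for this graph library, by symmetric digraphs:
  every edge contributes one arc in each direction. For an abelian group the definition below
  yields the null graph; by \<open>n_centralizer_group_not_comm\<close> this case does not arise for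
  \<open>n\<close>-centralizer groups with \<open>n \<noteq> 1\<close>.
\<close>
definition noncommuting_graph :: "('a, 'b) monoid_scheme \<Rightarrow> 'a pair_pre_digraph" where
  "noncommuting_graph G =
     \<lparr> pverts = carrier G - group_center G,
       parcs = {(x, y). x \<in> carrier G - group_center G \<and> y \<in> carrier G - group_center G \<and>
                        x \<otimes>\<^bsub>G\<^esub> y \<noteq> y \<otimes>\<^bsub>G\<^esub> x} \<rparr>"

lemma n_centralizer_group_not_comm:
  assumes "n_centralizer_group n G" and "n \<noteq> 1"
  shows "\<not> comm_group G"
proof
  assume "comm_group G"
  then interpret comm_group G .
  have "elem_centralizer G x = carrier G" if "x \<in> carrier G" for x
    using that by (auto simp: elem_centralizer_def m_comm)
  then have "elem_centralizer G ` carrier G = {carrier G}"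
    using one_closed by (auto simp: image_iff)
  then show False using assms by (simp add: n_centralizer_group_def)
qed

lemma pair_graph_noncommuting_graph:
  assumes "finite (carrier G)"
  shows "pair_graph (noncommuting_graph G)"
proof -
  let ?V = "pverts (noncommuting_graph G)"
  have V: "finite ?V" using assms by (simp add: noncommuting_graph_def)
  have "parcs (noncommuting_graph G) \<subseteq> ?V \<times> ?V" by (auto simp: noncommuting_graph_def)
  then have "finite (parcs (noncommuting_graph G))" using V by (meson finite_SigmaI finite_subset)
  with V show ?thesis
    by unfold_locales (auto simp: noncommuting_graph_def symmetric_def sym_def)
qed

text \<open>
  The matrices of a graph with rows and columns indexed along an enumeration \<open>vs\<close> of its
  vertices. In a symmetric digraph the out-degree of a vertex is its number of neighbours.
\<close>
definition adjacency_mat :: "'a pair_pre_digraph \<Rightarrow> 'a list \<Rightarrow> complex mat" where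
  "adjacency_mat \<Gamma> vs =
     mat (length vs) (length vs) (\<lambda>(i, j). if (vs ! i, vs ! j) \<in> parcs \<Gamma> then 1 else 0)"

definition degree_mat :: "'a pair_pre_digraph \<Rightarrow> 'a list \<Rightarrow> complex mat" where
  "degree_mat \<Gamma> vs =
     mat (length vs) (length vs)
       (\<lambda>(i, j). if i = j then of_nat (out_degree (with_proj \<Gamma>) (vs ! i)) else 0)"

definition laplacian_mat :: "'a pair_pre_digraph \<Rightarrow> 'a list \<Rightarrow> complex mat" where
  "laplacian_mat \<Gamma> vs = degree_mat \<Gamma> vs - adjacency_mat \<Gamma> vs"

text \<open>
  Different enumerations give permutation-similar Laplacian matrices, so the spectrum does not
  depend on the enumeration. The finiteness conjunct ensures that an enumeration exists.
\<close>
definition L_integral :: "'a pair_pre_digraph \<Rightarrow> bool" where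
  "L_integral \<Gamma> \<longleftrightarrow> finite (pverts \<Gamma>) \<and>
     (\<forall>vs. distinct vs \<and> set vs = pverts \<Gamma> \<longrightarrow>
        (\<forall>k. eigenvalue (laplacian_mat \<Gamma> vs) k \<longrightarrow> k \<in> \<int>))"

end

theory Submission
  imports Defs
begin

text \<open>
  If a non-central element \<open>x\<close> commuted with two non-commuting elements \<open>y\<close> and \<open>z\<close>, then the
  centralizers of \<open>x\<close>, \<open>y\<close>, \<open>z\<close> and \<open>yz\<close> would be four distinct proper centralizers, hence all
  of them. Each contains \<open>x\<close>; as the proper centralizers cover the non-central elements, \<open>x\<close>
  would be central. So commuting is an equivalence relation on the non-central elements, and the
  non-commuting graph is complete multipartite. On an eigenvector with non-zero eigenvalue \<open>k\<close>
  the total sum vanishes; if the sum over some part is non-zero then \<open>k\<close> is the number of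
  vertices, and otherwise \<open>k\<close> is the degree of a vertex in the support.
\<close>

lemma elem_centralizer_eq_carrier_iff:
  assumes "x \<in> carrier G"
  shows "elem_centralizer G x = carrier G \<longleftrightarrow> x \<in> group_center G"
  using assms by (auto simp: elem_centralizer_def group_center_def)

lemma five_centralizer_commute_trans:
  fixes G (structure)
  assumes G: "n_centralizer_group 5 G"
    and x: "x \<in> carrier G - group_center G" and y: "y \<in> carrier G" and z: "z \<in> carrier G"
    and xy: "x \<otimes> y = y \<otimes> x" and xz: "x \<otimes> z = z \<otimes> x"
  shows "y \<otimes> z = z \<otimes> y"
proof (rule ccontr)
  assume nc: "y \<otimes> z \<noteq> z \<otimes> y"
  interpret group G using G by (simp add: n_centralizer_group_def)
  let ?C = "elem_centralizer G" and ?P = "elem_centralizer G ` carrier G - {carrier G}"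
  have xc: "x \<in> carrier G" using x by simp
  have fin: "finite ?P" using G by (simp add: n_centralizer_group_def)
  have one: "\<one> \<in> group_center G" by (simp add: group_center_def)
  then have "carrier G \<in> ?C ` carrier G"
    using elem_centralizer_eq_carrier_iff[of \<one> G] one_closed by (metis image_eqI)
  \<comment> \<open>The whole group is itself one of the five centralizers, that of
    \<open>\<one>\<close>, so four proper ones remain.\<close>
  then have card: "card ?P = 4"
    using G by (simp add: n_centralizer_group_def)
  have yz: "y \<otimes> z \<in> carrier G" using y z by simp
  \<comment> \<open>Cancelling \<open>y\<close> on the left here, and \<open>z\<close> on the right
    in \<open>nc2\<close>, would return \<open>y \<otimes> z = z \<otimes> y\<close>.\<close>
  have nc1: "y \<otimes> z \<otimes> y \<noteq> y \<otimes> (y \<otimes> z)"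
    using nc y z by (simp add: m_assoc)
  have nc2: "y \<otimes> z \<otimes> z \<noteq> z \<otimes> (y \<otimes> z)"
    using nc y z by (simp flip: m_assoc)
  \<comment> \<open>The elements \<open>y\<close> and \<open>z\<close> separate the four
    centralizers: both, only \<open>y\<close>, only \<open>z\<close>, neither.\<close>
  have mem: "y \<in> ?C x" "z \<in> ?C x" "y \<in> ?C y" "z \<notin> ?C y" "z \<in> ?C z" "y \<notin> ?C z"
    "y \<notin> ?C (y \<otimes> z)" "z \<notin> ?C (y \<otimes> z)"
    using xc y z xy xz nc nc1 nc2 by (auto simp: elem_centralizer_def)
  have "?C x \<noteq> carrier G" using x elem_centralizer_eq_carrier_iff[OF xc] by simp
  then have "{?C x, ?C y, ?C z, ?C (y \<otimes> z)} \<subseteq> ?P"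
    using xc y z yz mem by auto
  moreover have "card {?C x, ?C y, ?C z, ?C (y \<otimes> z)} = 4"
  proof -
    have "?C x \<noteq> ?C y" "?C x \<noteq> ?C z" "?C x \<noteq> ?C (y \<otimes> z)" "?C y \<noteq> ?C z"
      "?C y \<noteq> ?C (y \<otimes> z)" "?C z \<noteq> ?C (y \<otimes> z)"
      using mem by blast+
    then show ?thesis by simp
  qed
  ultimately have P: "?P = {?C x, ?C y, ?C z, ?C (y \<otimes> z)}"
    using card fin by (metis card_subset_eq)
  have "x \<otimes> (y \<otimes> z) = y \<otimes> z \<otimes> x"
    using xc y z xy xz by (metis m_assoc)
  then have xP: "x \<in> A" if "A \<in> ?P" for A
    using that xc xy xz unfolding P by (auto simp: elem_centralizer_def)
  have "x \<otimes> w = w \<otimes> x" if w: "w \<in> carrier G" for w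
  proof (cases "w \<in> group_center G")
    case True
    then show ?thesis using xc by (simp add: group_center_def)
  next
    case False
    then have "x \<in> ?C w"
      using w xP elem_centralizer_eq_carrier_iff[OF w] by blast
    then show ?thesis by (simp add: elem_centralizer_def)
  qed
  then show False using x by (simp add: group_center_def)
qed

lemma complete_multipartite_laplacian_eigenvalue:
  fixes f :: "'v \<Rightarrow> complex"
  assumes fin: "finite V" and R: "equiv V R"
    and eig: "\<And>x. x \<in> V \<Longrightarrow>
      of_nat (card (V - R `` {x})) * f x - (\<Sum>y \<in> V - R `` {x}. f y) = k * f x"
    and nz: "u \<in> V" "f u \<noteq> 0"
  shows "k \<in> \<int>"
proof (cases "k = 0")
  case False
  have sub: "R `` {x} \<subseteq> V" for x using equiv_type[OF R] by auto
  have sym: "y \<in> R `` {x} \<longleftrightarrow> x \<in> R `` {y}" for x y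
    using R by (auto simp: equiv_def dest: symD)
  \<comment> \<open>Sum all eigenvalue equations. Exchanging the double sum counts each
    \<open>f y\<close> once per neighbour of \<open>y\<close>, which cancels the degree
    term.\<close>
  have "k * (\<Sum>x\<in>V. f x) = (\<Sum>x\<in>V. of_nat (card (V - R `` {x})) * f x)
      - (\<Sum>x\<in>V. \<Sum>y \<in> V - R `` {x}. f y)"
    by (simp add: sum_distrib_left eig[symmetric] sum_subtractf)
  also have "(\<Sum>x\<in>V. \<Sum>y \<in> V - R `` {x}. f y)
      = (\<Sum>x\<in>V. \<Sum>y\<in>V. if y \<notin> R `` {x} then f y else 0)"
    by (intro sum.cong refl sum.mono_neutral_cong_left) (use fin in auto)
  also have "\<dots> = (\<Sum>y\<in>V. \<Sum>x\<in>V. if x \<notin> R `` {y} then f y else 0)"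
    by (subst sum.swap) (simp only: sym)
  also have "\<dots> = (\<Sum>y\<in>V. \<Sum>x \<in> V - R `` {y}. f y)"
    by (intro sum.cong refl sum.mono_neutral_cong_right) (use fin in auto)
  finally have "(\<Sum>x\<in>V. f x) = 0" using False by simp
  then have comp: "(\<Sum>y \<in> V - R `` {x}. f y) = - (\<Sum>y \<in> R `` {x}. f y)" for x
    using sum_diff[OF fin sub, of f x] by simp
  have eig': "of_nat (card (V - R `` {x})) * f x + (\<Sum>y \<in> R `` {x}. f y) = k * f x"
    if "x \<in> V" for x
    using eig[OF that] comp[of x] by simp
  show ?thesis
  proof (cases "(\<Sum>y \<in> R `` {u}. f y) = 0")
    case True
    then have "k = of_nat (card (V - R `` {u}))"
      using eig'[OF nz(1)] nz(2) by simp
    then show ?thesis by simp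
  next
    case nzT: False
    let ?T = "\<Sum>y \<in> R `` {u}. f y" and ?c = "card (R `` {u})"
    \<comment> \<open>Sum over the part of \<open>u\<close> only: the degree is constant there, and
      the inner sum is \<open>?T\<close> for each of the \<open>?c\<close> members.\<close>
    have "k * ?T = (\<Sum>x \<in> R `` {u}. of_nat (card (V - R `` {x})) * f x + (\<Sum>y \<in> R `` {x}. f y))"
      unfolding sum_distrib_left using sub[of u] by (intro sum.cong refl eig'[symmetric]) blast
    also have "\<dots> = (\<Sum>x \<in> R `` {u}. of_nat (card (V - R `` {u})) * f x + ?T)"
      by (intro sum.cong refl) (use equiv_class_eq[OF R, of u] in auto)
    also have "\<dots> = of_nat (card (V - R `` {u}) + ?c) * ?T"
      by (simp add: sum.distrib distrib_right flip: sum_distrib_left)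
    finally have "k = of_nat (card (V - R `` {u}) + ?c)" using nzT by simp
    then show ?thesis by (metis Ints_of_nat)
  qed
qed simp

text \<open>This translates from matrices: an eigenvector indexed by positions in \<open>vs\<close>
  becomes a function on the vertices satisfying the equations of the previous lemma.\<close>

lemma L_integral_complete_multipartite:
  assumes fin: "finite (pverts \<Gamma>)" and R: "equiv (pverts \<Gamma>) R"
    and arcs: "parcs \<Gamma> = pverts \<Gamma> \<times> pverts \<Gamma> - R"
  shows "L_integral \<Gamma>"
  unfolding L_integral_def
proof (intro conjI allI impI, fact fin)
  fix vs k
  assume vs: "distinct vs \<and> set vs = pverts \<Gamma>" and "eigenvalue (laplacian_mat \<Gamma> vs) k"
  then obtain v where "eigenvector (laplacian_mat \<Gamma> vs) v k"
    by (auto simp: eigenvalue_def)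
  then have v: "v \<in> carrier_vec (length vs)" "v \<noteq> 0\<^sub>v (length vs)"
    and Lv: "laplacian_mat \<Gamma> vs *\<^sub>v v = k \<cdot>\<^sub>v v"
    by (auto simp: eigenvector_def laplacian_mat_def adjacency_mat_def)
  let ?n = "length vs" and ?V = "pverts \<Gamma>"
  have bij: "bij_betw ((!) vs) {..<?n} ?V"
    using vs by (simp add: bij_betw_nth)
  \<comment> \<open>The inverse of \<open>(!) vs\<close> returns the position of a vertex, unique
    because \<open>vs\<close> is distinct.\<close>
  define f where "f x = v $ the_inv_into {..<?n} ((!) vs) x" for x
  have f: "f (vs ! i) = v $ i" if "i < ?n" for i
    using that bij by (simp add: f_def the_inv_into_f_f bij_betw_def)
  have deg: "out_degree (with_proj \<Gamma>) x = card (?V - R `` {x})" if "x \<in> ?V" for x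
  proof -
    have "out_arcs (with_proj \<Gamma>) x = Pair x ` (?V - R `` {x})"
      using that arcs by (auto simp: out_arcs_def)
    then show ?thesis by (simp add: out_degree_def card_image inj_on_def)
  qed
  have eig: "of_nat (card (?V - R `` {x})) * f x - (\<Sum>y \<in> ?V - R `` {x}. f y) = k * f x"
    if x: "x \<in> ?V" for x
  proof -
    obtain i where i: "i < ?n" "vs ! i = x"
      using x vs by (metis in_set_conv_nth)
    have "k * f x = (laplacian_mat \<Gamma> vs *\<^sub>v v) $ i"
      using i f v Lv by auto
    also have "\<dots> = (\<Sum>j<?n. (if i = j then of_nat (out_degree (with_proj \<Gamma>) x) * v $ j else 0)
        - (if (x, vs ! j) \<in> parcs \<Gamma> then v $ j else 0))"
      using i v
      by (auto simp: laplacian_mat_def adjacency_mat_def degree_mat_def scalar_prod_def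
          lessThan_atLeast0 algebra_simps intro!: sum.cong)
    also have "\<dots> = of_nat (out_degree (with_proj \<Gamma>) x) * f x
        - (\<Sum>j<?n. if (x, vs ! j) \<in> parcs \<Gamma> then f (vs ! j) else 0)"
      using i f by (auto simp: sum_subtractf intro!: sum.cong)
    also have "(\<Sum>j<?n. if (x, vs ! j) \<in> parcs \<Gamma> then f (vs ! j) else 0)
        = (\<Sum>y\<in>?V. if (x, y) \<in> parcs \<Gamma> then f y else 0)"
      by (rule sum.reindex_bij_betw[OF bij])
    also have "\<dots> = (\<Sum>y \<in> ?V - R `` {x}. f y)"
      by (intro sum.mono_neutral_cong_right) (use fin x arcs in auto)
    finally show ?thesis using deg[OF x] by simp
  qed
  \<comment> \<open>A non-zero coordinate of \<open>v\<close> supplies the vertex where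
    \<open>f\<close> does not vanish.\<close>
  obtain i where i: "i < ?n" "v $ i \<noteq> 0"
    using v by (metis carrier_vecD eq_vecI index_zero_vec)
  show "k \<in> \<int>"
    by (rule complete_multipartite_laplacian_eigenvalue[OF fin R eig, of "vs ! i"])
      (use i f vs in auto)
qed

theorem proposition5p3:
  fixes G :: "('a, 'b) monoid_scheme"
  assumes "n_centralizer_group 5 G"
  shows "L_integral (noncommuting_graph G)"
proof -
  let ?V = "carrier G - group_center G"
  let ?R = "{(x, y). x \<in> ?V \<and> y \<in> ?V \<and> x \<otimes>\<^bsub>G\<^esub> y = y \<otimes>\<^bsub>G\<^esub> x}"
  have "trans ?R"
  proof (rule transI)
    fix x y z
    assume "(x, y) \<in> ?R" "(y, z) \<in> ?R"
    \<comment> \<open>The middle element \<open>y\<close> plays the non-central element that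
      commutes with both others.\<close>
    then show "(x, z) \<in> ?R"
      using five_centralizer_commute_trans[OF assms, of y x z] by simp
  qed
  then have "equiv ?V ?R"
    by (auto intro!: equivI refl_onI symI)
  then show ?thesis
    using assms
    by (intro L_integral_complete_multipartite[where R = ?R])
      (auto simp: noncommuting_graph_def n_centralizer_group_def)
qed

end
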